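(* Let $\varphi(t)$, $t>0$, and $\psi(x)$, $x\in\mathbb{R}$, be nonnegative functions which are related by $$\varphi(|t|)=\frac1{|t|}\int_0^\infty e^{-x/|t|}\psi(x)\,dx,\qquad t\in\mathbb{R}\setminus\{0\}.$$ Suppose that $\psi$ is even, that for some $M>0$ $$\int_0^\infty x^ke^{-x/M}\psi(x)\,dx<\infty\quad\text{for all }k\in\mathbb{N}_0,$$ and that $$\int_{-\infty}^\infty|x|^k\rho_{1/2,2}\left(\frac{x^2}{4}\right)\psi(x)\,dx<\infty\quad\text{for all }k\in\mathbb{N}_0 .$$ Let $\{P_n\}_{n\ge0}$ be the sequence of orthogonal (orthonormal) polynomials with respect to the measure $\frac{1}{2\sqrt\pi}\rho_{1/2,2}(x^2/4)\psi(x)\,dx$ over $\mathbb{R}$. Then $\{P_n\}_{n\ge0}$ is compositionally orthogonal in the sense of Hermite relatively to the function $\varphi(|t|)$, i.e. for all $n,m\in\mathbb{N}_0$ $$\int_{-\infty}^\infty P_n(\theta)P_m(\theta)\{\varphi(|t|)\}\,e^{-t^2}\,dt=\int_{-\infty}^\infty P_n(x)P_m(x)\,\rho_{1/2,2}\left(\frac{x^2}{4}\right)\psi(x)\,\frac{dx}{2\sqrt\pi}=\delta_{n,m}.$$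
   Context: $\theta=tDt$ with $D=d/dt$, i.e. $\theta\{f\}(t)=t\frac{d}{dt}\big(tf(t)\big)$, acting on functions of $t\in\mathbb{R}\setminus\{0\}$; for a polynomial $P(x)=\sum_kp_kx^k$, $P(\theta)=\sum_kp_k\theta^k$. For $x,\nu>0$ and $k\in\mathbb{N}_0$, $$\rho_{\nu,k}(x)=\frac1{2\pi i}\int_{\gamma-i\infty}^{\gamma+i\infty}\Gamma(s)^k\,\Gamma(\nu+s)\,x^{-s}\,ds,\qquad \gamma>0,$$ so $\rho_{1/2,2}(x)=\frac1{2\pi i}\int_{\gamma-i\infty}^{\gamma+i\infty}\Gamma(s)^2\Gamma(\tfrac12+s)x^{-s}ds$. Here $P_n$ is a real polynomial of degree $n$, and $\delta_{n,m}$ is the Kronecker symbol. *)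

theory Defs
  imports "HOL-Analysis.Analysis" "HOL-Computational_Algebra.Polynomial"
begin

text \<open>Functions on \<open>t \<noteq> 0\<close> are represented by total functions on the reals. At \<open>t \<noteq> 0\<close> the value
  of \<open>theta f\<close> depends only on \<open>f\<close> near \<open>t\<close>, so the value at \<open>0\<close> never enters.\<close>

definition theta :: "(real \<Rightarrow> real) \<Rightarrow> real \<Rightarrow> real" where
  "theta f = (\<lambda>t. t * deriv (\<lambda>u. u * f u) t)"

definition poly_theta :: "real poly \<Rightarrow> (real \<Rightarrow> real) \<Rightarrow> real \<Rightarrow> real" where
  "poly_theta p f = (\<lambda>t. \<Sum>k\<le>degree p. coeff p k * (theta ^^ k) f t)"

text \<open>The integral along the upward vertical line through \<open>c\<close>, parametrised by \<open>s = c + \<i> u\<close>,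
  \<open>ds = \<i> du\<close>.\<close>

definition vertical_integral :: "real \<Rightarrow> (complex \<Rightarrow> complex) \<Rightarrow> complex" where
  "vertical_integral c f = (LINT u|lborel. f (Complex c u) * \<i>)"

text \<open>The abscissa \<open>c > 0\<close> of the line is kept as a parameter. Taking \<open>Re\<close> loses nothing for
  \<open>x \<ge> 0\<close>, see \<open>of_real_rho\<close> below.\<close>

definition rho :: "real \<Rightarrow> real \<Rightarrow> nat \<Rightarrow> real \<Rightarrow> real" where
  "rho c \<nu> k x = Re (1 / (2 * of_real pi * \<i>) *
     vertical_integral c (\<lambda>s. Gamma s ^ k * Gamma (of_real \<nu> + s) * of_real x powr (- s)))"

lemma of_real_rho:
  assumes "x \<ge> 0"
  shows "complex_of_real (rho c \<nu> k x) = 1 / (2 * of_real pi * \<i>) *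
     vertical_integral c (\<lambda>s. Gamma s ^ k * Gamma (of_real \<nu> + s) * of_real x powr (- s))"
proof -
  define f where "f = (\<lambda>s. Gamma s ^ k * Gamma (of_real \<nu> + s) * complex_of_real x powr (- s))"
  define I where "I = (LINT u|lborel. f (Complex c u))"
  have cnj_f: "cnj (f s) = f (cnj s)" for s
  proof -
    have "cnj (complex_of_real x powr (- s)) = complex_of_real x powr (- cnj s)"
      using assms by (subst cnj_powr) auto
    moreover have "cnj (Gamma z) = Gamma (cnj z)" for z :: complex
      by (simp add: cnj_Gamma)
    ultimately show ?thesis by (simp add: f_def)
  qed
  have cnj_line: "cnj (f (Complex c u)) = f (Complex c (- u))" for u
    by (simp add: cnj_f complex_cnj)
  have "cnj I = (LINT u|lborel. cnj (f (Complex c u)))"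
    by (simp add: I_def)
  also have "\<dots> = (LINT u|lborel. f (Complex c (- u)))"
    by (simp only: cnj_line)
  also have "\<dots> = I"
    unfolding I_def
    using lborel_integral_real_affine[of "-1" "\<lambda>u. f (Complex c u)" 0] by simp
  finally have "Im I = 0"
    by (metis Reals_cnj_iff complex_is_Real_iff)
  moreover have "1 / (2 * of_real pi * \<i>) * vertical_integral c f = I / of_real (2 * pi)"
    by (simp add: vertical_integral_def I_def)
  ultimately have "Im (1 / (2 * of_real pi * \<i>) * vertical_integral c f) = 0"
    by (simp only: Im_divide_of_real)
  then show ?thesis
    unfolding rho_def f_def[symmetric] by (simp add: complex_eq_iff)
qed

definition orthonormal_polys :: "real measure \<Rightarrow> (nat \<Rightarrow> real poly) \<Rightarrow> bool" where
  "orthonormal_polys M P \<longleftrightarrow>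
     (\<forall>n. degree (P n) = n) \<and>
     (\<forall>n m. integrable M (\<lambda>x. poly (P n) x * poly (P m) x)) \<and>
     (\<forall>n m. (LINT x|M. poly (P n) x * poly (P m) x) = of_bool (n = m))"

end

theory Submission imports Defs "HOL-Probability.Probability" begin

text \<open>Legendre duplication turns \<open>\<Gamma>(s)\<^sup>2 \<Gamma>(1/2 + s)\<close> into a multiple of \<open>\<Gamma>(s) \<Gamma>(2s)\<close>. Writing
  \<open>\<Gamma>(s)\<close> as a Gaussian integral and applying the Cahen--Mellin formula to \<open>\<Gamma>(2s)\<close>, one finds that
  \<open>\<rho>(x\<^sup>2/4) / (2 \<surd>\<pi>)\<close> is the integral of \<open>e\<^bsup>-t\<^sup>2 - |x|/t\<^esup> / t\<close> over \<open>t > 0\<close>. On the other hand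
  \<open>\<theta>\<close> acts on \<open>e\<^bsup>-x/|t|\<^esup> / |t|\<close> as multiplication by \<open>x\<close> for \<open>t > 0\<close> and by \<open>-x\<close> for \<open>t < 0\<close>. So
  \<open>P\<^sub>n(\<theta>) P\<^sub>m(\<theta>)\<close> puts the factor \<open>P\<^sub>n P\<^sub>m\<close> under the integral that defines \<open>\<phi>\<close>, and Fubini's theorem
  gives the claim.\<close>

subsection \<open>The Gamma function on vertical lines\<close>

text \<open>Serves the two exchanges of integration with Gamma below: the modulus of a positive real
  raised to a complex power depends only on the real part of the exponent, so on a vertical line
  each integrand is bounded by a function of u times a function of t.\<close>

lemma integrable_pair_bound_mult:
  fixes f :: "'a \<times> 'b \<Rightarrow> 'c::{banach, second_countable_topology}" and g :: "'a \<Rightarrow> real" and h :: "'b \<Rightarrow> real"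
  assumes "pair_sigma_finite M N" and f[measurable]: "f \<in> borel_measurable (M \<Otimes>\<^sub>M N)"
    and g: "integrable M g" and h: "integrable N h"
    and le: "\<And>x y. norm (f (x, y)) \<le> g x * h y"
  shows "integrable (M \<Otimes>\<^sub>M N) f"
proof -
  interpret pair_sigma_finite M N by fact
  have [measurable]: "g \<in> borel_measurable M" "h \<in> borel_measurable N"
    using g h by auto
  have "integrable (M \<Otimes>\<^sub>M N) (\<lambda>(x, y). g x * h y)"
  proof (rule Fubini_integrable)
    have "integrable M (\<lambda>x. \<bar>g x\<bar> * (LINT y|N. \<bar>h y\<bar>))"
      using g by (intro integrable_mult_left integrable_abs)
    then show "integrable M (\<lambda>x. LINT y|N. norm (case (x, y) of (x, y) \<Rightarrow> g x * h y))"
      by (simp add: abs_mult)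
  qed (use h in auto)
  then show ?thesis
    by (rule Bochner_Integration.integrable_bound) (auto intro!: AE_I2 order_trans[OF le])
qed

text \<open>Transfers the change of variables theorem for absolutely integrable functions to Bochner
  integrals. The two measurability assumptions allow the passage between \<open>lebesgue\<close> and
  \<open>lborel\<close>; the equivalence carries integrability and value together.\<close>

lemma has_bochner_integral_substitution_real:
  fixes f :: "real \<Rightarrow> 'a :: euclidean_space" and g :: "real \<Rightarrow> real"
  assumes S: "S \<in> sets borel" and gS: "g ` S = T" "T \<in> sets borel"
    and der: "\<And>x. x \<in> S \<Longrightarrow> (g has_field_derivative h x) (at x)"
    and inj: "inj_on g S"
    and meas: "(\<lambda>x. indicator T x *\<^sub>R f x) \<in> borel_measurable borel"
      "(\<lambda>x. indicator S x *\<^sub>R (\<bar>h x\<bar> *\<^sub>R f (g x))) \<in> borel_measurable borel"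
  shows "has_bochner_integral lborel (\<lambda>x. indicator S x *\<^sub>R (\<bar>h x\<bar> *\<^sub>R f (g x))) b
    \<longleftrightarrow> has_bochner_integral lborel (\<lambda>x. indicator T x *\<^sub>R f x) b"
proof -
  have *: "has_bochner_integral lborel (\<lambda>x. indicator A x *\<^sub>R k x) b
      \<longleftrightarrow> k absolutely_integrable_on A \<and> integral A k = b"
    if "(\<lambda>x. indicator A x *\<^sub>R k x) \<in> borel_measurable borel" for A and k :: "real \<Rightarrow> 'a"
  proof -
    have "has_bochner_integral lborel (\<lambda>x. indicator A x *\<^sub>R k x) b
      \<longleftrightarrow> set_integrable lebesgue A k \<and> (LINT x:A|lebesgue. k x) = b"
      using that by (simp add: has_bochner_integral_iff set_integrable_def set_lebesgue_integral_def
          integrable_completion integral_completion)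
    then show ?thesis
      using set_lebesgue_integral_eq_integral(2)[of A k] by auto
  qed
  show ?thesis
    unfolding *[OF meas(1)] *[OF meas(2)] unfolding gS(1)[symmetric]
    by (rule has_absolute_integral_change_of_variables_real)
      (use S der inj in \<open>auto intro: has_field_derivative_at_within\<close>)
qed

lemma borel_measurable_powr_complex_of_real [measurable (raw)]:
  fixes f :: "'a \<Rightarrow> real" and g :: "'a \<Rightarrow> complex"
  assumes [measurable]: "f \<in> borel_measurable M" "g \<in> borel_measurable M"
  shows "(\<lambda>x. complex_of_real (f x) powr g x) \<in> borel_measurable M"
proof -
  \<comment> \<open>The principal logarithm of a nonzero real is \<open>ln \<bar>f x\<bar>\<close>,
    plus pi i on the negative axis, and a power of 0 is 0 by convention. Each piece is visibly
    measurable, although the complex logarithm jumps along its cut.\<close>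
  have "(\<lambda>x. complex_of_real (f x) powr g x) = (\<lambda>x. if f x = 0 then 0 else
      exp (g x * (of_real (ln \<bar>f x\<bar>) + (if f x < 0 then pi * \<i> else 0))))"
    by (auto simp: fun_eq_iff powr_def Ln_of_real')
  also have "\<dots> \<in> borel_measurable M"
    by measurable
  finally show ?thesis .
qed

section \<open>Euler's integral, its Gaussian form, and decay of Gamma on vertical lines\<close>

lemma has_bochner_integral_Gamma:
  assumes "Re z > 0"
  shows "has_bochner_integral lborel
    (\<lambda>t. indicator {0<..} t *\<^sub>R (of_real t powr (z - 1) * of_real (exp (- t)))) (Gamma z)"
proof -
  define f where "f = (\<lambda>t. complex_of_real t powr (z - 1) / of_real (exp t))"
  have f: "f absolutely_integrable_on {0<..}"
    unfolding f_def by (rule absolutely_integrable_Gamma_integral') fact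
  have I: "(f has_integral Gamma z) {0<..}"
    unfolding f_def by (rule Gamma_integral_complex') fact
  have m: "(\<lambda>t. indicator {0<..} t *\<^sub>R f t) \<in> borel_measurable lborel"
    unfolding f_def by measurable
  have "has_bochner_integral lborel (\<lambda>t. indicator {0<..} t *\<^sub>R f t) (Gamma z)"
    using f I set_lebesgue_integral_eq_integral(2)[OF f] m
    by (simp add: has_bochner_integral_iff set_integrable_def set_lebesgue_integral_def
        integrable_completion integral_completion integral_unique)
  then show ?thesis
    by (simp add: f_def exp_minus divide_inverse)
qed

text \<open>Substitute t^2 for the variable in Euler's integral. This is the source of the weight
  e^(-t^2) in the orthogonality relation.\<close>

lemma has_bochner_integral_Gamma_square:
  assumes "Re z > 0"
  shows "has_bochner_integral lborel
    (\<lambda>t. indicator {0<..} t *\<^sub>R (of_real t powr (2 * z - 1) * of_real (exp (- t\<^sup>2)))) (Gamma z / 2)"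
proof -
  define f where "f = (\<lambda>t. complex_of_real t powr (z - 1) * of_real (exp (- t)))"
  have img: "(\<lambda>t::real. t\<^sup>2) ` {0<..} = {0<..}"
  proof -
    have "x \<in> (\<lambda>t::real. t\<^sup>2) ` {0<..}" if "x > 0" for x :: real
      using that by (intro image_eqI[of _ _ "sqrt x"]) auto
    then show ?thesis by auto
  qed
  have inj: "inj_on (\<lambda>t::real. t\<^sup>2) {0<..}"
    by (auto simp: inj_on_def power2_eq_iff_nonneg)
  have I: "has_bochner_integral lborel (\<lambda>t. indicator {0<..} t *\<^sub>R (\<bar>2 * t\<bar> *\<^sub>R f (t\<^sup>2))) (Gamma z)"
  proof (subst has_bochner_integral_substitution_real[of _ _ "{0<..}"])
    show "(\<lambda>t. indicator {0<..} t *\<^sub>R f t) \<in> borel_measurable borel"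
      "(\<lambda>t. indicator {0<..} t *\<^sub>R (\<bar>2 * t\<bar> *\<^sub>R f (t\<^sup>2))) \<in> borel_measurable borel"
      unfolding f_def by measurable
  qed (use assms img inj has_bochner_integral_Gamma[OF assms] in
      \<open>auto simp: f_def intro!: derivative_eq_intros\<close>)
  have *: "\<bar>2 * t\<bar> *\<^sub>R f (t\<^sup>2) = 2 * (of_real t powr (2 * z - 1) * of_real (exp (- t\<^sup>2)))" if "t > 0" for t
  proof -
    have "of_real (t\<^sup>2) powr (z - 1) * complex_of_real t = of_real t powr (2 * z - 1)"
    proof -
      have "of_real (t\<^sup>2) powr (z - 1) = exp ((z - 1) * (2 * of_real (ln t)))"
        using that by (simp add: powr_def Ln_of_real ln_realpow flip: of_real_power)
      moreover have "complex_of_real t = exp (of_real (ln t))"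
        using that by (simp add: exp_of_real)
      ultimately show ?thesis
        using that by (simp add: powr_def Ln_of_real algebra_simps flip: exp_add)
    qed
    then show ?thesis using that
      by (simp add: f_def scaleR_conv_of_real algebra_simps)
  qed
  have eq: "(\<lambda>t. 1 / 2 * (indicator {0<..} t *\<^sub>R (\<bar>2 * t\<bar> *\<^sub>R f (t\<^sup>2)))) =
      (\<lambda>t. indicator {0<..} t *\<^sub>R (of_real t powr (2 * z - 1) * of_real (exp (- t\<^sup>2))))"
  proof
    show "1 / 2 * (indicator {0<..} t *\<^sub>R (\<bar>2 * t\<bar> *\<^sub>R f (t\<^sup>2))) =
      indicator {0<..} t *\<^sub>R (of_real t powr (2 * z - 1) * of_real (exp (- t\<^sup>2)))" for t
      using *[of t] by (cases "t > 0") auto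
  qed
  show ?thesis
    using has_bochner_integral_mult_right[OF I, of "1 / 2"] unfolding eq by simp
qed

lemma Complex_not_nonpos_Ints: "c > 0 \<Longrightarrow> Complex c u \<notin> \<int>\<^sub>\<le>\<^sub>0"
  by (auto elim!: nonpos_Ints_cases simp: complex_eq_iff)

lemma continuous_Gamma_vertical:
  "c > 0 \<Longrightarrow> continuous_on UNIV (\<lambda>u. Gamma (Complex c u))"
  by (intro continuous_on_compose2[OF continuous_on_Gamma[of "{s. Re s > 0}"]])
    (auto simp: Complex_not_nonpos_Ints Complex_eq elim!: nonpos_Ints_cases intro!: continuous_intros)

lemma measurable_Gamma_vertical [measurable]:
  "c > 0 \<Longrightarrow> (\<lambda>u. Gamma (Complex c u)) \<in> borel_measurable borel"
  by (intro borel_measurable_continuous_onI continuous_Gamma_vertical)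

text \<open>The modulus of t^(z-1) is t^(Re z - 1) for t > 0, so the triangle inequality for Euler's
  integral suffices.\<close>

lemma norm_Gamma_le:
  assumes "Re z > 0"
  shows "norm (Gamma z) \<le> Gamma (Re z)"
proof -
  have 1: "has_bochner_integral lborel
    (\<lambda>t. indicator {0<..} t *\<^sub>R (of_real t powr (z - 1) * of_real (exp (- t)))) (Gamma z)"
    by (rule has_bochner_integral_Gamma) fact
  have 2: "has_bochner_integral lborel
    (\<lambda>t. indicator {0<..} t *\<^sub>R (of_real t powr (of_real (Re z) - 1) * of_real (exp (- t)))) (Gamma (complex_of_real (Re z)))"
    by (rule has_bochner_integral_Gamma) (use assms in simp)
  have "norm (Gamma z) \<le> (LINT t|lborel. norm (indicator {0<..} t *\<^sub>R (of_real t powr (z - 1) * complex_of_real (exp (- t)))))"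
    unfolding has_bochner_integral_integral_eq[OF 1, symmetric] by (rule integral_norm_bound)
  also have "\<dots> = (LINT t|lborel. Re (indicator {0<..} t *\<^sub>R (of_real t powr (of_real (Re z) - 1) * of_real (exp (- t)))))"
  proof (intro Bochner_Integration.integral_cong refl)
    fix t :: real
    have "complex_of_real t powr (of_real (Re z) - 1) = of_real (t powr (Re z - 1))" if "t > 0"
      using powr_of_real[of t "Re z - 1"] that by simp
    then show "norm (indicator {0<..} t *\<^sub>R (of_real t powr (z - 1) * complex_of_real (exp (- t)))) =
        Re (indicator {0<..} t *\<^sub>R (of_real t powr (of_real (Re z) - 1) * of_real (exp (- t))))"
      by (auto simp: indicator_def norm_mult norm_powr_real_powr)
  qed
  also have "\<dots> = Re (Gamma (complex_of_real (Re z)))"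
    unfolding has_bochner_integral_integral_eq[OF 2, symmetric]
    by (rule integral_bounded_linear[OF bounded_linear_Re]) (use 2 in \<open>auto simp: has_bochner_integral_iff\<close>)
  finally show ?thesis by (simp add: Gamma_complex_of_real)
qed

text \<open>Two steps of the functional equation give Gamma(s) = Gamma(s+2) / (s (s+1)), whose
  numerator is bounded on the line. The resulting quadratic decay is enough, and Stirling's formula
  is avoided.\<close>

lemma integrable_Gamma_vertical:
  assumes c: "c > 0"
  shows "integrable lborel (\<lambda>u. Gamma (Complex c u))"
proof -
  have "integrable lborel (\<lambda>u::real. Gamma (c + 2) / min (c\<^sup>2) 1 * inverse (1 + u\<^sup>2))"
    using integrable_inverse_1_plus_square by (intro integrable_mult_right) (simp add: set_integrable_def)
  then show ?thesis
  proof (rule Bochner_Integration.integrable_bound)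
    show "AE u in lborel. norm (Gamma (Complex c u)) \<le> norm (Gamma (c + 2) / min (c\<^sup>2) 1 * inverse (1 + u\<^sup>2))"
    proof (rule AE_I2)
      fix u
      define s where "s = Complex c u"
      have "Gamma (s + 2) = (s + 1) * (s * Gamma s)"
        using Gamma_plus1[of s] Gamma_plus1[of "s + 1"] Complex_not_nonpos_Ints[of c u] Complex_not_nonpos_Ints[of "c + 1" u] c
        by (simp add: s_def complex_eq_iff Complex_eq add_ac)
      moreover have "norm (Gamma (s + 2)) \<le> Gamma (c + 2)"
        using norm_Gamma_le[of "s + 2"] c by (simp add: s_def)
      ultimately have 1: "norm (s + 1) * norm s * norm (Gamma s) \<le> Gamma (c + 2)"
        by (simp add: norm_mult)
      \<comment> \<open>The minimum makes c^2 + u^2 comparable to 1 + u^2 for small and large c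
        alike.\<close>
      have "min (c\<^sup>2) 1 * (1 + u\<^sup>2) \<le> c\<^sup>2 + u\<^sup>2"
        using mult_right_mono[of "min (c\<^sup>2) 1" 1 "u\<^sup>2"] by (simp add: algebra_simps)
      also have "\<dots> = norm s * norm s"
        by (simp add: s_def cmod_def)
      also have "\<dots> \<le> norm (s + 1) * norm s"
        using c by (intro mult_right_mono) (auto simp: s_def cmod_def intro!: power_mono)
      finally have "min (c\<^sup>2) 1 * (1 + u\<^sup>2) * norm (Gamma s) \<le> norm (s + 1) * norm s * norm (Gamma s)"
        by (rule mult_right_mono) simp
      with 1 have "min (c\<^sup>2) 1 * (1 + u\<^sup>2) * norm (Gamma s) \<le> Gamma (c + 2)" by linarith
      moreover have "min (c\<^sup>2) 1 > 0" "1 + u\<^sup>2 > 0" using c by (auto simp: add_pos_nonneg)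
      ultimately have "norm (Gamma s) \<le> Gamma (c + 2) / min (c\<^sup>2) 1 * inverse (1 + u\<^sup>2)"
        by (simp add: pos_le_divide_eq inverse_eq_divide del: min_less_iff_conj) (simp add: mult_ac)
      then show "norm (Gamma (Complex c u)) \<le> norm (Gamma (c + 2) / min (c\<^sup>2) 1 * inverse (1 + u\<^sup>2))"
        unfolding s_def real_norm_def by (rule order_trans[OF _ abs_ge_self])
    qed
  qed (use c in measurable)
qed

subsection \<open>The Cahen--Mellin formula\<close>

text \<open>The characteristic function of the standard normal distribution, rescaled by \<sigma>.
  Frequency \<tau> = 0 also provides the integrability of Gaussians wherever it is needed.\<close>

lemma has_bochner_integral_gaussian_fourier:
  fixes \<sigma> \<tau> :: real
  assumes "\<sigma> > 0"
  shows "has_bochner_integral lborel (\<lambda>u. iexp (\<tau> * u) * of_real (exp (- (\<sigma> * u)\<^sup>2 / 2)))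
    (complex_of_real (sqrt (2 * pi) / \<sigma> * exp (- (\<tau> / \<sigma>)\<^sup>2 / 2)))"
proof -
  define f where "f = (\<lambda>x. std_normal_density x *\<^sub>R iexp (\<tau> / \<sigma> * x))"
  have "integrable lborel f"
    by (rule Bochner_Integration.integrable_bound[OF integrable_normal_density[of 1 0]])
      (auto simp: f_def)
  moreover have "integral\<^sup>L lborel f = of_real (exp (- (\<tau> / \<sigma>)\<^sup>2 / 2))"
    using fun_cong[OF char_std_normal_distribution, of "\<tau> / \<sigma>"]
    by (simp add: char_def integral_density f_def)
  ultimately have "has_bochner_integral lborel f (of_real (exp (- (\<tau> / \<sigma>)\<^sup>2 / 2)))"
    by (simp add: has_bochner_integral_iff)
  then have "has_bochner_integral lborel (\<lambda>u. f (0 + \<sigma> * u)) (of_real (exp (- (\<tau> / \<sigma>)\<^sup>2 / 2)) /\<^sub>R \<bar>\<sigma>\<bar>)"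
    by (subst (asm) lborel_has_bochner_integral_real_affine_iff[of \<sigma> _ _ 0]) (use assms in auto)
  then have "has_bochner_integral lborel (\<lambda>u. of_real (sqrt (2 * pi)) * f (0 + \<sigma> * u))
      (of_real (sqrt (2 * pi)) * (of_real (exp (- (\<tau> / \<sigma>)\<^sup>2 / 2)) /\<^sub>R \<bar>\<sigma>\<bar>))"
    by (rule has_bochner_integral_mult_right)
  moreover have "of_real (sqrt (2 * pi)) * f (0 + \<sigma> * u) = iexp (\<tau> * u) * of_real (exp (- (\<sigma> * u)\<^sup>2 / 2))" for u
    using assms by (simp add: f_def std_normal_density_def scaleR_conv_of_real mult_ac)
  ultimately show ?thesis
    using assms by (simp add: scaleR_conv_of_real field_simps)
qed

text \<open>For a \<ge> 0 use e^a \<ge> a^2/2 and complete the square; for a < 0 the left side is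
  not positive. The bound is free of a, which later gives a majorant that is uniform in the
  damping.\<close>

lemma exp_linear_minus_exp_le:
  fixes c y a :: real
  assumes "c > 0" "y > 0"
  shows "c * a - y * exp a \<le> c\<^sup>2 / (2 * y)"
proof (cases "a \<ge> 0")
  case True
  have "a\<^sup>2 / 2 \<le> exp a"
    using exp_lower_Taylor_quadratic[OF True] True by simp
  then have "y * (a\<^sup>2 / 2) \<le> y * exp a" using assms by simp
  moreover have "c * a - y * (a\<^sup>2 / 2) = c\<^sup>2 / (2 * y) - (c - y * a)\<^sup>2 / (2 * y)"
    using assms by (simp add: field_simps power2_eq_square)
  moreover have "(c - y * a)\<^sup>2 / (2 * y) \<ge> 0" using assms by simp
  ultimately show ?thesis by linarith
next
  case False
  then have "c * a \<le> 0" "y * exp a \<ge> 0" using assms by (auto simp: mult_nonneg_nonpos)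
  moreover have "c\<^sup>2 / (2 * y) \<ge> 0" using assms by simp
  ultimately show ?thesis by linarith
qed

text \<open>Mellin inversion with Gaussian damping. Insert Euler's integral for Gamma; the damping
  makes the double integral absolutely convergent, so the order can be exchanged. The integral over
  u is then the Fourier transform of a Gaussian at ln(t/y), and t = y e^(\<sigma> w) rescales the
  result to a standard Gaussian in w.\<close>

lemma Gamma_vertical_gaussian_eq:
  assumes c: "c > 0" and y: "y > 0" and \<sigma>: "\<sigma> > 0"
  shows "(LINT u|lborel. Gamma (Complex c u) * of_real y powr (- Complex c u) * of_real (exp (- (\<sigma> * u)\<^sup>2 / 2)))
    = of_real (LINT w|lborel. sqrt (2 * pi) * exp (c * (\<sigma> * w) - y * exp (\<sigma> * w)) * exp (- w\<^sup>2 / 2))"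
proof -
  define G where "G = (\<lambda>u t. indicator {0<..} t *\<^sub>R (of_real t powr (Complex c u - 1) * complex_of_real (exp (- t)))
    * (of_real y powr (- Complex c u) * of_real (exp (- (\<sigma> * u)\<^sup>2 / 2))))"
  have G_int: "integrable (lborel \<Otimes>\<^sub>M lborel) (\<lambda>(u, t). G u t)"
  proof (rule integrable_pair_bound_mult)
    show "pair_sigma_finite lborel lborel" ..
    have "(\<lambda>u. Complex c u) \<in> borel_measurable borel"
      by (simp add: Complex_eq)
    then show "(\<lambda>(u, t). G u t) \<in> borel_measurable (lborel \<Otimes>\<^sub>M lborel)"
      unfolding G_def by measurable
    \<comment> \<open>The factor \<open>iexp (0 * u)\<close> is 1; written this way, the majorant is
      an instance of the Fourier formula at frequency 0.\<close>
    show "integrable lborel (\<lambda>u. norm (iexp (0 * u) * of_real (exp (- (\<sigma> * u)\<^sup>2 / 2))))"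
      using has_bochner_integral_gaussian_fourier[OF \<sigma>, of 0]
      by (intro integrable_norm) (simp add: has_bochner_integral_iff)
    show "integrable lborel (\<lambda>t. norm (indicator {0<..} t *\<^sub>R (of_real t powr (Complex c 0 - 1) * complex_of_real (exp (- t))) * of_real (y powr - c)))"
      using has_bochner_integral_Gamma[of "Complex c 0"] c
      by (intro integrable_norm integrable_mult_left) (simp add: has_bochner_integral_iff)
    show "norm (case (u, t) of (u, t) \<Rightarrow> G u t) \<le> norm (iexp (0 * u) * of_real (exp (- (\<sigma> * u)\<^sup>2 / 2))) *
      norm (indicator {0<..} t *\<^sub>R (of_real t powr (Complex c 0 - 1) * complex_of_real (exp (- t))) * of_real (y powr - c))" for u t
      using y by (auto simp: G_def norm_mult indicator_def norm_powr_real_powr)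
  qed
  have inner: "(LINT u|lborel. G u t) = of_real (indicator {0<..} t * (t powr (c - 1) * exp (- t) * y powr - c
      * (sqrt (2 * pi) / \<sigma> * exp (- (ln (t / y) / \<sigma>)\<^sup>2 / 2))))" for t
  proof (cases "t > 0")
    case True
    have "G u t = of_real (t powr (c - 1) * exp (- t) * y powr - c) *
        (iexp (ln (t / y) * u) * of_real (exp (- (\<sigma> * u)\<^sup>2 / 2)))" for u
    proof -
      have "of_real t powr (Complex c u - 1) = of_real (t powr (c - 1)) * iexp (ln t * u)"
        using True by (simp add: powr_def Ln_of_real Complex_eq algebra_simps flip: exp_add exp_of_real)
      moreover have "of_real y powr (- Complex c u) = of_real (y powr - c) * iexp (- ln y * u)"
        using y by (simp add: powr_def Ln_of_real Complex_eq algebra_simps flip: exp_add exp_of_real)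
      moreover have "iexp (ln (t / y) * u) = iexp (ln t * u) * iexp (- ln y * u)"
        using True y by (simp add: ln_div algebra_simps flip: exp_add)
      ultimately show ?thesis using True by (simp add: G_def)
    qed
    then show ?thesis
      using True has_bochner_integral_integral_eq[OF has_bochner_integral_gaussian_fourier[OF \<sigma>, of "ln (t / y)"]]
      by simp
  qed (simp add: G_def)
  define f where "f = (\<lambda>t. t powr (c - 1) * exp (- t) * y powr - c
      * (sqrt (2 * pi) / \<sigma> * exp (- (ln (t / y) / \<sigma>)\<^sup>2 / 2)))"
  have "integrable lborel (\<lambda>t. LINT u|lborel. G u t)"
    using lborel_pair.integrable_snd[OF G_int] .
  then have "integrable lborel (\<lambda>t. indicator {0<..} t *\<^sub>R f t)"
    unfolding inner complex_of_real_integrable_eq by (simp add: f_def)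
  then have f: "has_bochner_integral lborel (\<lambda>t. indicator {0<..} t *\<^sub>R f t) (LINT t|lborel. indicator {0<..} t *\<^sub>R f t)"
    by (rule has_bochner_integral_integrable)
  have img: "range (\<lambda>w. y * exp (\<sigma> * w)) = {0<..}"
  proof -
    have "t \<in> range (\<lambda>w. y * exp (\<sigma> * w))" if "t > 0" for t
      using that y \<sigma> by (intro image_eqI[of _ _ "ln (t / y) / \<sigma>"]) auto
    then show ?thesis using y by auto
  qed
  \<comment> \<open>This substitution is the inverse of w = ln(t/y) / \<sigma>, the quantity squared
    in the Gaussian; its Jacobian cancels the factor 1/\<sigma>.\<close>
  have "has_bochner_integral lborel (\<lambda>w. indicator UNIV w *\<^sub>R (\<bar>y * \<sigma> * exp (\<sigma> * w)\<bar> *\<^sub>R f (y * exp (\<sigma> * w))))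
      (LINT t|lborel. indicator {0<..} t *\<^sub>R f t)"
  proof (subst has_bochner_integral_substitution_real[where g = "\<lambda>w. y * exp (\<sigma> * w)" and T = "{0<..}"
        and f = f and h = "\<lambda>w. y * \<sigma> * exp (\<sigma> * w)"])
    show "(\<lambda>t. indicator {0<..} t *\<^sub>R f t) \<in> borel_measurable borel"
      "(\<lambda>w. indicator UNIV w *\<^sub>R (\<bar>y * \<sigma> * exp (\<sigma> * w)\<bar> *\<^sub>R f (y * exp (\<sigma> * w)))) \<in> borel_measurable borel"
      unfolding f_def by measurable
    show "inj_on (\<lambda>w. y * exp (\<sigma> * w)) UNIV"
      using y \<sigma> by (auto simp: inj_on_def)
  qed (use f img in \<open>auto intro!: derivative_eq_intros\<close>)
  moreover have "\<bar>y * \<sigma> * exp (\<sigma> * w)\<bar> *\<^sub>R f (y * exp (\<sigma> * w))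
      = sqrt (2 * pi) * exp (c * (\<sigma> * w) - y * exp (\<sigma> * w)) * exp (- w\<^sup>2 / 2)" for w
  proof -
    have "(y * exp (\<sigma> * w)) powr (c - 1) * y powr - c * (y * exp (\<sigma> * w)) = exp (c * (\<sigma> * w))"
      using y by (simp add: powr_def ln_mult algebra_simps flip: exp_add)
        (simp add: exp_add exp_diff exp_minus)
    then show ?thesis
      using y \<sigma> by (simp add: f_def exp_diff exp_minus field_simps)
  qed
  ultimately have *: "(LINT t|lborel. indicator {0<..} t *\<^sub>R f t) =
      (LINT w|lborel. sqrt (2 * pi) * exp (c * (\<sigma> * w) - y * exp (\<sigma> * w)) * exp (- w\<^sup>2 / 2))"
    by (simp add: has_bochner_integral_iff)
  have "(LINT t|lborel. G u t) = Gamma (Complex c u) * of_real y powr (- Complex c u) * of_real (exp (- (\<sigma> * u)\<^sup>2 / 2))" for u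
    unfolding G_def integral_mult_left_zero
    by (subst has_bochner_integral_integral_eq[OF has_bochner_integral_Gamma]) (use c in auto)
  then have "(LINT u|lborel. Gamma (Complex c u) * of_real y powr (- Complex c u) * of_real (exp (- (\<sigma> * u)\<^sup>2 / 2)))
      = (LINT u|lborel. LINT t|lborel. G u t)"
    by simp
  also have "\<dots> = (LINT t|lborel. LINT u|lborel. G u t)"
    by (rule lborel_pair.Fubini_integral[symmetric]) (rule G_int)
  also have "\<dots> = (LINT t|lborel. of_real (indicator {0<..} t *\<^sub>R f t))"
    unfolding inner by (simp add: f_def)
  finally show ?thesis
    unfolding integral_complex_of_real * .
qed

text \<open>The Cahen--Mellin integral, by letting the Gaussian damping tend to 1.\<close>

lemma has_bochner_integral_Cahen_Mellin:
  assumes c: "c > 0" and y: "y > 0"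
  shows "has_bochner_integral lborel (\<lambda>u. Gamma (Complex c u) * of_real y powr (- Complex c u))
    (of_real (2 * pi * exp (- y)))"
proof -
  define g where "g = (\<lambda>u. Gamma (Complex c u) * of_real y powr (- Complex c u))"
  define \<sigma> where "\<sigma> = (\<lambda>n. inverse (real (Suc n)))"
  have \<sigma>: "\<sigma> n > 0" "\<sigma> \<longlonglongrightarrow> 0" for n
    unfolding \<sigma>_def by (simp, rule LIMSEQ_inverse_real_of_nat)
  have [measurable]: "(\<lambda>u. Complex c u) \<in> borel_measurable borel"
    by (simp add: Complex_eq)
  have g_meas [measurable]: "g \<in> borel_measurable borel"
    unfolding g_def using c by measurable
  have g: "integrable lborel g"
    by (rule Bochner_Integration.integrable_bound[OF integrable_mult_left[OF integrable_Gamma_vertical[OF c], of "of_real (y powr - c)"]])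
      (use y g_meas[unfolded g_def] in \<open>auto simp: g_def norm_mult norm_powr_real_powr\<close>)
  \<comment> \<open>First limit: the damping factor is at most 1, so the modulus of \<open>g\<close>
    is a majorant and the undamped integral appears.\<close>
  have "(\<lambda>n. LINT u|lborel. g u * of_real (exp (- (\<sigma> n * u)\<^sup>2 / 2))) \<longlonglongrightarrow> (LINT u|lborel. g u * of_real (exp (- (0 * u)\<^sup>2 / 2)))"
  proof (rule integral_dominated_convergence[of _ _ _ "\<lambda>u. norm (g u)"])
    show "AE u in lborel. (\<lambda>n. g u * of_real (exp (- (\<sigma> n * u)\<^sup>2 / 2)))
        \<longlonglongrightarrow> g u * of_real (exp (- (0 * u)\<^sup>2 / 2))"
      by (intro AE_I2 tendsto_intros \<sigma>) simp
  qed (use g in \<open>auto simp: norm_mult mult_left_le\<close>)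
  then have 1: "(\<lambda>n. LINT u|lborel. g u * of_real (exp (- (\<sigma> n * u)\<^sup>2 / 2))) \<longlonglongrightarrow> integral\<^sup>L lborel g"
    by simp
  define h where "h = (\<lambda>s w. sqrt (2 * pi) * exp (c * (s * w) - y * exp (s * w)) * exp (- w\<^sup>2 / 2))"
  have density: "2 * pi * std_normal_density w = sqrt (2 * pi) * exp (- w\<^sup>2 / 2)" for w
  proof -
    have "2 * pi * std_normal_density w = 2 * pi / sqrt (2 * pi) * exp (- w\<^sup>2 / 2)"
      by (simp add: std_normal_density_def)
    also have "2 * pi / sqrt (2 * pi) = sqrt (2 * pi)"
      by (rule real_div_sqrt) simp
    finally show ?thesis .
  qed
  \<comment> \<open>Second limit, for the same quantities in the variable w:
    \<open>exp_linear_minus_exp_le\<close> bounds the exponential factor for all n at once, leaving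
    a multiple of the normal density.\<close>
  have "(\<lambda>n. LINT w|lborel. h (\<sigma> n) w) \<longlonglongrightarrow> (LINT w|lborel. h 0 w)"
  proof (rule integral_dominated_convergence)
    show "integrable lborel (\<lambda>w. 2 * pi * exp (c\<^sup>2 / (2 * y)) * std_normal_density w)"
      by (intro integrable_mult_right integrable_normal_density) simp
    show "AE w in lborel. norm (h (\<sigma> n) w) \<le> 2 * pi * exp (c\<^sup>2 / (2 * y)) * std_normal_density w" for n
    proof (rule AE_I2)
      fix w
      have "exp (c * (\<sigma> n * w) - y * exp (\<sigma> n * w)) \<le> exp (c\<^sup>2 / (2 * y))"
        using exp_linear_minus_exp_le[OF c y] by simp
      then have "sqrt (2 * pi) * exp (- w\<^sup>2 / 2) * exp (c * (\<sigma> n * w) - y * exp (\<sigma> n * w)) \<le>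
          sqrt (2 * pi) * exp (- w\<^sup>2 / 2) * exp (c\<^sup>2 / (2 * y))"
        by (intro mult_left_mono) auto
      also have "\<dots> = 2 * pi * exp (c\<^sup>2 / (2 * y)) * std_normal_density w"
        unfolding density[symmetric] by (simp add: mult_ac)
      finally show "norm (h (\<sigma> n) w) \<le> 2 * pi * exp (c\<^sup>2 / (2 * y)) * std_normal_density w"
        by (simp add: h_def mult_ac abs_mult)
    qed
    show "AE w in lborel. (\<lambda>n. h (\<sigma> n) w) \<longlonglongrightarrow> h 0 w"
      unfolding h_def by (intro AE_I2 tendsto_intros \<sigma>) auto
  qed (auto simp: h_def)
  \<comment> \<open>At damping 0 the exponent is the constant -y, and the normal density has total
    mass 1.\<close>
  moreover have "(LINT w|lborel. h 0 w) = 2 * pi * exp (- y)"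
  proof -
    have "h 0 w = exp (- y) * (2 * pi * std_normal_density w)" for w
      unfolding density h_def by simp
    then show ?thesis by simp
  qed
  ultimately have "(\<lambda>n. complex_of_real (LINT w|lborel. h (\<sigma> n) w)) \<longlonglongrightarrow> of_real (2 * pi * exp (- y))"
    by (intro tendsto_of_real) simp
  moreover have "(LINT u|lborel. g u * of_real (exp (- (\<sigma> n * u)\<^sup>2 / 2))) = of_real (LINT w|lborel. h (\<sigma> n) w)" for n
    unfolding g_def h_def by (rule Gamma_vertical_gaussian_eq[OF c y \<sigma>(1)])
  ultimately have "integral\<^sup>L lborel g = of_real (2 * pi * exp (- y))"
    using 1 LIMSEQ_unique by simp
  with g show ?thesis
    by (simp add: has_bochner_integral_iff g_def)
qed

subsection \<open>An integral representation of the weight\<close>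

text \<open>The kernel e^(-x/t)/t of \<phi> times the Gaussian weight: the inner integral that
  Fubini's theorem will produce. For x \<le> 0 the integral diverges and its formal value is
  0.\<close>

definition rho_kernel :: "real \<Rightarrow> real" where
  "rho_kernel x = (LINT t|lborel. indicator {0<..} t * (exp (- t\<^sup>2 - x / t) / t))"

lemma borel_measurable_rho_kernel [measurable]: "rho_kernel \<in> borel_measurable borel"
  unfolding rho_kernel_def by measurable

text \<open>Since e^a \<ge> a at a = x/t, the singular factor e^(-x/t)/t is at most 1/x, and a
  Gaussian remains.\<close>

lemma integrable_rho_kernel:
  fixes x :: real
  assumes x: "x > 0"
  shows "integrable lborel (\<lambda>t. indicator {0<..} t * (exp (- t\<^sup>2 - x / t) / t))"
proof (rule Bochner_Integration.integrable_bound)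
  \<comment> \<open>The width \<sigma> = sqrt 2 and frequency 0 turn the Gaussian into
    e^(-t^2).\<close>
  have "integrable lborel (\<lambda>t. norm (iexp (0 * t) * of_real (exp (- (sqrt 2 * t)\<^sup>2 / 2))))"
    using has_bochner_integral_gaussian_fourier[of "sqrt 2" 0]
    by (intro integrable_norm) (simp add: has_bochner_integral_iff)
  then have "integrable lborel (\<lambda>t::real. exp (- t\<^sup>2))"
    by (simp add: norm_mult power_mult_distrib)
  then show "integrable lborel (\<lambda>t::real. exp (- t\<^sup>2) * (1 / x))"
    by (rule integrable_mult_left)
  show "AE t in lborel. norm (indicator {0<..} t * (exp (- t\<^sup>2 - x / t) / t)) \<le> norm (exp (- t\<^sup>2) * (1 / x))"
  proof (rule AE_I2)
    fix t :: real
    show "norm (indicator {0<..} t * (exp (- t\<^sup>2 - x / t) / t)) \<le> norm (exp (- t\<^sup>2) * (1 / x))"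
    proof (cases "t > 0")
      case True
      have "x / t \<le> exp (x / t)"
        using exp_ge_add_one_self[of "x / t"] by linarith
      then have "exp (- (x / t)) / t \<le> 1 / x"
        using x True by (simp add: exp_minus field_simps)
      then have "exp (- t\<^sup>2) * (exp (- (x / t)) / t) \<le> exp (- t\<^sup>2) * (1 / x)"
        by (intro mult_left_mono) auto
      moreover have "exp (- t\<^sup>2 - x / t) / t = exp (- t\<^sup>2) * (exp (- (x / t)) / t)"
        by (simp flip: exp_add)
      ultimately show ?thesis
        using x True by simp
    qed simp
  qed
qed measurable

text \<open>Only the part of the integral over s \<le> t \<le> 2s is kept; there e^(-x/t) is at
  least e^(-x/s). With s arbitrary, integrability against the weight yields Laplace integrals at
  every positive argument.\<close>

lemma exp_le_rho_kernel:
  assumes s: "s > 0"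
  obtains C where "C > 0" "\<And>x. x > 0 \<Longrightarrow> exp (- x / s) \<le> C * rho_kernel x"
proof
  \<comment> \<open>The minimum of e^(-t^2)/t on [s, 2s], attained at t = 2s, times the length s of
    that interval.\<close>
  define c where "c = exp (- (2 * s)\<^sup>2) / (2 * s) * s"
  have c: "c > 0" using s by (simp add: c_def)
  then show "1 / c > 0" by simp
  fix x :: real assume x: "x > 0"
  have "(LINT t|lborel. indicator {s..2 * s} t * (exp (- (2 * s)\<^sup>2) / (2 * s) * exp (- x / s))) \<le> rho_kernel x"
    unfolding rho_kernel_def
  proof (rule integral_mono)
    show "integrable lborel (\<lambda>t. indicator {s..2 * s} t * (exp (- (2 * s)\<^sup>2) / (2 * s) * exp (- x / s)))"
      using s by (intro integrable_mult_left integrable_real_indicator) (auto simp: emeasure_lborel_Icc)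
    show "integrable lborel (\<lambda>t. indicator {0<..} t * (exp (- t\<^sup>2 - x / t) / t))"
      by (rule integrable_rho_kernel) fact
    fix t :: real
    have "exp (- (2 * s)\<^sup>2) / (2 * s) * exp (- x / s) \<le> exp (- t\<^sup>2) / t * exp (- x / t)" if "s \<le> t" "t \<le> 2 * s"
      using that s x power_mono[of t "2 * s" 2]
      by (intro mult_mono frac_le)
        (auto intro!: divide_left_mono power_mono mult_pos_pos simp: minus_divide_left[symmetric])
    moreover have "exp (- t\<^sup>2) / t * exp (- x / t) = exp (- t\<^sup>2 - x / t) / t"
      by (simp flip: exp_add)
    ultimately show "indicator {s..2 * s} t * (exp (- (2 * s)\<^sup>2) / (2 * s) * exp (- x / s)) \<le>
        indicator {0<..} t * (exp (- t\<^sup>2 - x / t) / t)"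
      using s by (cases "t \<in> {s..2 * s}") (auto simp: indicator_def)
  qed
  also have "(LINT t|lborel. indicator {s..2 * s} t * (exp (- (2 * s)\<^sup>2) / (2 * s) * exp (- x / s))) = c * exp (- x / s)"
    using s by (simp add: c_def)
  finally show "exp (- x / s) \<le> 1 / c * rho_kernel x"
    using c by (simp add: field_simps)
qed

lemma rho_kernel_pos: "x > 0 \<Longrightarrow> rho_kernel x > 0"
  using exp_le_rho_kernel[of 1] by (metis exp_gt_zero less_le_trans zero_less_mult_pos zero_less_one)

text \<open>Cahen--Mellin on the line of abscissa 2c; replacing u by 2u halves the constant.\<close>

lemma has_bochner_integral_Cahen_Mellin_double:
  assumes c: "c > 0" and y: "y > 0"
  shows "has_bochner_integral lborel
    (\<lambda>u. Gamma (2 * Complex c u) * of_real y powr (- (2 * Complex c u))) (of_real (pi * exp (- y)))"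
proof -
  have "has_bochner_integral lborel (\<lambda>u. Gamma (Complex (2 * c) u) * of_real y powr (- Complex (2 * c) u))
    (of_real (2 * pi * exp (- y)))"
    by (rule has_bochner_integral_Cahen_Mellin) (use assms in auto)
  then show ?thesis
    by (subst (asm) lborel_has_bochner_integral_real_affine_iff[of 2 _ _ 0])
      (simp_all add: scaleR_conv_of_real Complex_eq algebra_simps)
qed

text \<open>Gamma(s) is replaced by its Gaussian integral over t, while Gamma(2s) stays and supplies
  absolute convergence, so this exchange requires no damping. For fixed t the powers combine to
  (x/t)^(-2s), and the integral over u becomes e^(-x/t) by Cahen--Mellin.\<close>

lemma Gamma_vertical_integral_eq_rho_kernel:
  assumes c: "c > 0" and x: "x > 0"
  shows "(LINT u|lborel. Gamma (Complex c u) * Gamma (2 * Complex c u) * of_real x powr (- (2 * Complex c u)))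
    = of_real (2 * pi * rho_kernel x)"
proof -
  \<comment> \<open>The factor 2 offsets the half in
    \<open>has_bochner_integral_Gamma_square\<close>.\<close>
  define G where "G = (\<lambda>u t. indicator {0<..} t *\<^sub>R (of_real t powr (2 * Complex c u - 1) * complex_of_real (exp (- t\<^sup>2)))
    * (2 * Gamma (2 * Complex c u) * of_real x powr (- (2 * Complex c u))))"
  have [measurable]: "(\<lambda>u. Complex c u) \<in> borel_measurable borel"
    by (simp add: Complex_eq)
  have double: "2 * Complex c u = Complex (2 * c) (2 * u)" for u
    by (simp add: complex_eq_iff)
  have [measurable]: "(\<lambda>u. Gamma (2 * Complex c u)) \<in> borel_measurable borel"
    unfolding double using c
    by (intro borel_measurable_continuous_onI continuous_on_compose2[OF continuous_Gamma_vertical[of "2 * c"]])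
      (auto intro: continuous_intros)
  have G_int: "integrable (lborel \<Otimes>\<^sub>M lborel) (\<lambda>(u, t). G u t)"
  proof (rule integrable_pair_bound_mult)
    show "pair_sigma_finite lborel lborel" ..
    show "(\<lambda>(u, t). G u t) \<in> borel_measurable (lborel \<Otimes>\<^sub>M lborel)"
      unfolding G_def by measurable
    show "integrable lborel (\<lambda>u. norm (2 * (Gamma (2 * Complex c u) * of_real x powr (- (2 * Complex c u)))))"
      using has_bochner_integral_Cahen_Mellin_double[OF c x]
      by (intro integrable_norm integrable_mult_right) (simp add: has_bochner_integral_iff)
    show "integrable lborel (\<lambda>t. norm (indicator {0<..} t *\<^sub>R (of_real t powr (2 * Complex c 0 - 1) * complex_of_real (exp (- t\<^sup>2)))))"
      using has_bochner_integral_Gamma_square[of "Complex c 0"] c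
      by (intro integrable_norm) (simp add: has_bochner_integral_iff)
    show "norm (case (u, t) of (u, t) \<Rightarrow> G u t) \<le> norm (2 * (Gamma (2 * Complex c u) * of_real x powr (- (2 * Complex c u)))) *
      norm (indicator {0<..} t *\<^sub>R (of_real t powr (2 * Complex c 0 - 1) * complex_of_real (exp (- t\<^sup>2))))" for u t
      by (auto simp: G_def norm_mult indicator_def norm_powr_real_powr)
  qed
  have inner: "(LINT u|lborel. G u t) = of_real (2 * pi * (indicator {0<..} t * (exp (- t\<^sup>2 - x / t) / t)))" for t
  proof (cases "t > 0")
    case True
    have "G u t = of_real (2 * exp (- t\<^sup>2) / t) * (Gamma (2 * Complex c u) * of_real (x / t) powr (- (2 * Complex c u)))" for u
    proof -
      have "of_real t powr (2 * Complex c u - 1) = of_real t powr (2 * Complex c u) / of_real t"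
        using True by (simp add: powr_diff)
      moreover have "complex_of_real (x / t) powr (- (2 * Complex c u))
          = of_real x powr (- (2 * Complex c u)) * of_real t powr (2 * Complex c u)"
        using True x by (simp add: powr_def Ln_of_real ln_div algebra_simps flip: exp_add of_real_divide)
      ultimately show ?thesis using True by (simp add: G_def)
    qed
    then show ?thesis
      using True x has_bochner_integral_integral_eq[OF has_bochner_integral_Cahen_Mellin_double[OF c, of "x / t"]]
      by (simp add: exp_diff exp_minus divide_inverse)
  qed (simp add: G_def)
  have "(LINT t|lborel. G u t) = Gamma (Complex c u) * Gamma (2 * Complex c u) * of_real x powr (- (2 * Complex c u))" for u
    unfolding G_def integral_mult_left_zero
    by (subst has_bochner_integral_integral_eq[OF has_bochner_integral_Gamma_square]) (use c in auto)
  then have "(LINT u|lborel. Gamma (Complex c u) * Gamma (2 * Complex c u) * of_real x powr (- (2 * Complex c u)))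
      = (LINT u|lborel. LINT t|lborel. G u t)"
    by simp
  also have "\<dots> = (LINT t|lborel. LINT u|lborel. G u t)"
    by (rule lborel_pair.Fubini_integral[symmetric]) (rule G_int)
  also have "\<dots> = of_real (2 * pi * rho_kernel x)"
    unfolding inner integral_complex_of_real rho_kernel_def integral_mult_right_zero ..
  finally show ?thesis .
qed

text \<open>Duplication gives Gamma(s) Gamma(s + 1/2) = 2^(1-2s) sqrt(pi) Gamma(2s). The argument
  x^2/4 is what makes 4^s cancel 2^(-2s), leaving |x|^(-2s). The right side is free of c, so the
  position of the line is immaterial.\<close>

lemma rho_half_two:
  assumes c: "c > 0" and x: "x \<noteq> 0"
  shows "rho c (1/2) 2 (x\<^sup>2 / 4) = 2 * sqrt pi * rho_kernel \<bar>x\<bar>"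
proof -
  have "Gamma s ^ 2 * Gamma (of_real (1/2) + s) * of_real (x\<^sup>2 / 4) powr (- s)
      = of_real (2 * sqrt pi) * (Gamma s * Gamma (2 * s) * of_real \<bar>x\<bar> powr (- (2 * s)))"
    if s: "s = Complex c u" for s u
  proof -
    have "Gamma s * Gamma (s + 1/2) = exp ((1 - 2 * s) * of_real (ln 2)) * of_real (sqrt pi) * Gamma (2 * s)"
      by (rule Gamma_legendre_duplication)
        (use Complex_not_nonpos_Ints[OF c, of u] Complex_not_nonpos_Ints[of "c + 1/2" u] c in
          \<open>simp_all add: s Complex_eq add_ac\<close>)
    moreover have "exp ((1 - 2 * s) * of_real (ln 2)) * of_real (x\<^sup>2 / 4) powr (- s)
        = 2 * of_real \<bar>x\<bar> powr (- (2 * s))"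
    proof -
      have ln4: "ln (x\<^sup>2 / 4) = 2 * ln \<bar>x\<bar> - 2 * ln 2"
      proof -
        have "ln (x\<^sup>2 / 4) = ln ((\<bar>x\<bar> / 2)\<^sup>2)" by (simp add: power_divide)
        also have "\<dots> = 2 * ln \<bar>x\<bar> - 2 * ln 2" using x by (simp add: ln_realpow ln_div)
        finally show ?thesis .
      qed
      have "of_real (x\<^sup>2 / 4) powr (- s) = exp (- s * of_real (ln (x\<^sup>2 / 4)))"
        using x Ln_of_real[of "x\<^sup>2 / 4"] by (simp add: powr_def del: of_real_power of_real_divide)
      moreover have "of_real \<bar>x\<bar> powr (- (2 * s)) = exp (- (2 * s) * of_real (ln \<bar>x\<bar>))"
        using x by (simp add: powr_def Ln_of_real)
      moreover have "exp ((1 - 2 * s) * of_real (ln 2)) * exp (- s * of_real (2 * ln \<bar>x\<bar> - 2 * ln 2))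
          = exp (of_real (ln 2)) * exp (- (2 * s) * of_real (ln \<bar>x\<bar>))"
        by (simp add: algebra_simps flip: exp_add)
      moreover have "exp (of_real (ln 2)) = (2::complex)"
        unfolding exp_of_real by simp
      ultimately show ?thesis
        unfolding ln4 by simp
    qed
    ultimately show ?thesis
      by (simp add: power2_eq_square mult_ac add.commute)
  qed
  then have "vertical_integral c (\<lambda>s. Gamma s ^ 2 * Gamma (of_real (1/2) + s) * of_real (x\<^sup>2 / 4) powr (- s))
      = of_real (2 * sqrt pi) * of_real (2 * pi * rho_kernel \<bar>x\<bar>) * \<i>"
    using x by (simp add: vertical_integral_def Gamma_vertical_integral_eq_rho_kernel[OF c] del: of_real_mult)
  then show ?thesis
    unfolding rho_def by simp
qed

subsection \<open>The action of theta\<close>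

text \<open>Completion keeps the measure of Borel sets, so a countable cover for
  \<open>lborel\<close> still works. Fubini's theorem will be applied with \<open>lebesgue\<close>
  as one factor.\<close>

lemma sigma_finite_measure_lebesgue: "sigma_finite_measure (lebesgue :: 'a::euclidean_space measure)"
proof -
  obtain A :: "'a set set" where "countable A" "A \<subseteq> sets lborel" "\<Union>A = space lborel"
    "\<forall>a\<in>A. emeasure lborel a \<noteq> \<infinity>"
    using lborel.sigma_finite_countable by blast
  then show ?thesis
    by (intro sigma_finite_measure.intro exI[of _ A]) (auto simp: emeasure_completion main_part_sets)
qed

text \<open>Demanding every \<epsilon> > 0 makes the class closed under multiplication by
  polynomials, which iterating \<open>theta\<close> calls for.\<close>

definition laplace_transformable :: "(real \<Rightarrow> real) \<Rightarrow> bool" where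
  "laplace_transformable q \<longleftrightarrow> (\<forall>\<epsilon>>0. integrable (lebesgue_on {0..}) (\<lambda>x. exp (- (\<epsilon> * x)) * q x))"

definition laplace :: "(real \<Rightarrow> real) \<Rightarrow> real \<Rightarrow> real" where
  "laplace q s = (LINT x|lebesgue_on {0..}. exp (- (s * x)) * q x)"

lemma laplace_transformableD:
  "laplace_transformable q \<Longrightarrow> \<epsilon> > 0 \<Longrightarrow> integrable (lebesgue_on {0..}) (\<lambda>x. exp (- (\<epsilon> * x)) * q x)"
  by (simp add: laplace_transformable_def)

lemma borel_measurable_id_lebesgue_on: "(\<lambda>x::real. x) \<in> borel_measurable (lebesgue_on S)"
  by (intro measurable_restrict_space1 measurable_completion) simp

lemma laplace_transformable_measurable:
  assumes "laplace_transformable q"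
  shows "q \<in> borel_measurable (lebesgue_on {0..})"
proof -
  note borel_measurable_id_lebesgue_on[measurable]
  have [measurable]: "(\<lambda>x. exp (- (1 * x)) * q x) \<in> borel_measurable (lebesgue_on {0..})"
    by (intro borel_measurable_integrable laplace_transformableD assms) simp
  have "(\<lambda>x. exp x * (exp (- (1 * x)) * q x)) \<in> borel_measurable (lebesgue_on {0..})"
    by measurable
  then show ?thesis
    by (simp add: exp_minus flip: mult.assoc)
qed

text \<open>Half of the exponential decay pays for the factor x, because \<epsilon> x / 2 \<le>
  e^(\<epsilon> x / 2).\<close>

lemma laplace_transformable_mult_id:
  assumes "laplace_transformable q"
  shows "laplace_transformable (\<lambda>x. x * q x)"
  unfolding laplace_transformable_def
proof (intro allI impI)
  note borel_measurable_id_lebesgue_on[measurable] laplace_transformable_measurable[OF assms, measurable]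
  fix \<epsilon> :: real assume \<epsilon>: "\<epsilon> > 0"
  have "integrable (lebesgue_on {0..}) (\<lambda>x. 2 / \<epsilon> * (exp (- (\<epsilon> / 2 * x)) * q x))"
    using \<epsilon> by (intro integrable_mult_right laplace_transformableD assms) simp
  then show "integrable (lebesgue_on {0..}) (\<lambda>x. exp (- (\<epsilon> * x)) * (x * q x))"
  proof (rule Bochner_Integration.integrable_bound)
    have "exp (- (\<epsilon> * x)) * x \<le> 2 / \<epsilon> * exp (- (\<epsilon> / 2 * x))" for x
    proof -
      have "\<epsilon> / 2 * x \<le> exp (\<epsilon> / 2 * x)"
        using exp_ge_add_one_self[of "\<epsilon> / 2 * x"] by linarith
      then have "x * exp (- (\<epsilon> * x)) \<le> 2 / \<epsilon> * exp (\<epsilon> / 2 * x) * exp (- (\<epsilon> * x))"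
        using \<epsilon> by (intro mult_right_mono) (simp_all add: field_simps)
      moreover have "exp (\<epsilon> / 2 * x) * exp (- (\<epsilon> * x)) = exp (- (\<epsilon> / 2 * x))"
        by (simp add: field_simps flip: exp_add)
      ultimately show ?thesis by (simp add: mult_ac)
    qed
    then have "\<bar>exp (- (\<epsilon> * x)) * (x * q x)\<bar> \<le> \<bar>2 / \<epsilon> * (exp (- (\<epsilon> / 2 * x)) * q x)\<bar>" if "x \<ge> 0" for x
      using mult_right_mono[of "exp (- (\<epsilon> * x)) * x" "2 / \<epsilon> * exp (- (\<epsilon> / 2 * x))" "\<bar>q x\<bar>"] that \<epsilon>
      by (simp add: abs_mult mult.assoc)
    then show "AE x in lebesgue_on {0..}. norm (exp (- (\<epsilon> * x)) * (x * q x)) \<le> norm (2 / \<epsilon> * (exp (- (\<epsilon> / 2 * x)) * q x))"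
      by (intro AE_I2) auto
  qed measurable
qed

text \<open>Induction along Horner's scheme. The scale \<open>a\<close> will be the sign of
  t.\<close>

lemma laplace_transformable_poly_mult:
  assumes "laplace_transformable q"
  shows "laplace_transformable (\<lambda>x. poly p (a * x) * q x)"
proof (induction p)
  case (pCons c p)
  have "integrable (lebesgue_on {0..}) (\<lambda>x. c * (exp (- (\<epsilon> * x)) * q x) + a * (exp (- (\<epsilon> * x)) * (x * (poly p (a * x) * q x))))"
    if "\<epsilon> > 0" for \<epsilon>
    using assms laplace_transformable_mult_id[OF pCons.IH] that
    by (intro Bochner_Integration.integrable_add integrable_mult_right) (auto simp: laplace_transformable_def)
  then show ?case
    by (simp add: laplace_transformable_def algebra_simps)
qed (simp add: laplace_transformable_def)

text \<open>Differentiation under the integral by a direct estimate: the first-order remainder is at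
  most a constant times (y - s)^2, the constant being a Laplace integral of x^2 q at s/2.\<close>

lemma laplace_has_field_derivative:
  assumes q: "laplace_transformable q" and s: "s > 0"
  shows "(laplace q has_field_derivative - laplace (\<lambda>x. x * q x) s) (at s)"
proof -
  note borel_measurable_id_lebesgue_on[measurable] laplace_transformable_measurable[OF q, measurable]
  have xq: "laplace_transformable (\<lambda>x. x * q x)" and xxq: "laplace_transformable (\<lambda>x. x * (x * q x))"
    by (intro laplace_transformable_mult_id q)+
  define C where "C = (LINT x|lebesgue_on {0..}. norm (exp (- (s / 2 * x)) * (x * (x * q x))))"
  have bound: "norm (laplace q y - laplace q s - - laplace (\<lambda>x. x * q x) s * (y - s)) \<le> (y - s)\<^sup>2 * C"
    if "dist y s < s / 2" for y
  proof -
    define h where "h = y - s"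
    have h: "\<bar>h\<bar> < s / 2" "y = s + h" "y > 0"
      using that s unfolding h_def dist_real_def by linarith+
    define D where "D = (\<lambda>x. exp (- (y * x)) * q x - exp (- (s * x)) * q x + h * (exp (- (s * x)) * (x * q x)))"
    have ints: "integrable (lebesgue_on {0..}) (\<lambda>x. exp (- (y * x)) * q x)"
      "integrable (lebesgue_on {0..}) (\<lambda>x. exp (- (s * x)) * q x)"
      "integrable (lebesgue_on {0..}) (\<lambda>x. exp (- (s * x)) * (x * q x))"
      using q xq s h by (auto simp: laplace_transformable_def)
    have "laplace q y - laplace q s - - laplace (\<lambda>x. x * q x) s * (y - s) = (LINT x|lebesgue_on {0..}. D x)"
      using ints by (simp add: laplace_def D_def h_def)
    also have "norm \<dots> \<le> (LINT x|lebesgue_on {0..}. h\<^sup>2 * norm (exp (- (s / 2 * x)) * (x * (x * q x))))"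
    proof (rule Bochner_Integration.integral_norm_bound_integral)
      show "integrable (lebesgue_on {0..}) D"
        unfolding D_def using ints by (intro Bochner_Integration.integrable_add Bochner_Integration.integrable_diff integrable_mult_right)
      show "integrable (lebesgue_on {0..}) (\<lambda>x. h\<^sup>2 * norm (exp (- (s / 2 * x)) * (x * (x * q x))))"
        using s by (intro integrable_mult_right integrable_norm laplace_transformableD xxq) simp
      fix x assume "x \<in> space (lebesgue_on {0::real..})"
      then have x: "x \<ge> 0" by simp
      \<comment> \<open>Taylor's formula of first order. As h may be negative, a growing factor e^|h
        x| remains; |h| < s/2 lets half of the decay e^(-s x) absorb it.\<close>
      have "\<bar>exp (- (h * x)) - 1 + h * x\<bar> \<le> exp \<bar>h * x\<bar> * (h * x)\<^sup>2"
        using Taylor_exp_field[of "- (h * x)" 1] by (simp add: power2_eq_square)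
      also have "\<dots> \<le> exp (s / 2 * x) * (h * x)\<^sup>2"
        using mult_right_mono[of "\<bar>h\<bar>" "s / 2" x] h(1) x by (intro mult_right_mono) (auto simp: abs_mult)
      finally have "exp (- (s * x)) * \<bar>exp (- (h * x)) - 1 + h * x\<bar> \<le> exp (- (s * x)) * (exp (s / 2 * x) * (h * x)\<^sup>2)"
        by (rule mult_left_mono) simp
      also have "\<dots> = exp (- (s / 2 * x)) * (h * x)\<^sup>2"
        unfolding mult.assoc[symmetric] exp_add[symmetric] by simp
      finally have "exp (- (s * x)) * \<bar>exp (- (h * x)) - 1 + h * x\<bar> * \<bar>q x\<bar> \<le> exp (- (s / 2 * x)) * (h * x)\<^sup>2 * \<bar>q x\<bar>"
        by (rule mult_right_mono) simp
      moreover have "D x = exp (- (s * x)) * (exp (- (h * x)) - 1 + h * x) * q x"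
      proof -
        have "exp (- (y * x)) = exp (- (s * x)) * exp (- (h * x))"
          unfolding h(2) by (simp add: algebra_simps flip: exp_add)
        then show ?thesis by (simp add: D_def algebra_simps)
      qed
      ultimately show "norm (D x) \<le> h\<^sup>2 * norm (exp (- (s / 2 * x)) * (x * (x * q x)))"
        using x by (simp add: abs_mult power_mult_distrib power2_eq_square mult_ac)
    qed
    finally show ?thesis
      by (simp add: C_def h_def)
  qed
  show ?thesis
    unfolding has_field_derivative_def
  proof (rule has_derivativeI_sandwich)
    show "bounded_linear ((*) (- laplace (\<lambda>x. x * q x) s))"
      by (rule bounded_linear_mult_right)
    show "norm (laplace q y - laplace q s - - laplace (\<lambda>x. x * q x) s * (y - s)) / norm (y - s) \<le> \<bar>y - s\<bar> * C"
      if "y \<noteq> s" "dist y s < s / 2" for y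
      using bound[OF that(2)] that(1) by (simp add: divide_le_eq power2_eq_square mult_ac flip: abs_mult)
    show "((\<lambda>y. \<bar>y - s\<bar> * C) \<longlongrightarrow> 0) (at s)"
      by (rule tendsto_eq_intros refl | simp)+
  qed (use s in auto)
qed

text \<open>For \<open>q\<close> = \<psi> and \<open>p\<close> = 1 this is \<phi>(|t|) when t is
  nonzero. The sign of t enters through the polynomial because \<open>theta\<close> multiplies the
  integrand by sgn t * x.\<close>

definition two_sided_laplace :: "(real \<Rightarrow> real) \<Rightarrow> real poly \<Rightarrow> real \<Rightarrow> real" where
  "two_sided_laplace q p t = 1 / \<bar>t\<bar> * laplace (\<lambda>x. poly p (sgn t * x) * q x) (1 / \<bar>t\<bar>)"

text \<open>Where u has the sign of t, u F(u) equals sgn t times a Laplace transform at sgn t / u,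
  so the chain rule applies. \<open>F\<close> is prescribed only away from 0, so that the statement
  also covers iterates of \<open>theta\<close>, whose value at 0 is arbitrary.\<close>

lemma two_sided_laplace_derivative:
  assumes q: "laplace_transformable q" and F: "\<And>u. u \<noteq> 0 \<Longrightarrow> F u = two_sided_laplace q p u" and t: "t \<noteq> 0"
  shows "((\<lambda>u. u * F u) has_field_derivative two_sided_laplace q (pCons 0 p) t / t) (at t)"
proof -
  define r where "r = (\<lambda>x. poly p (sgn t * x) * q x)"
  have r: "laplace_transformable r"
    unfolding r_def by (rule laplace_transformable_poly_mult) fact
  have pos: "sgn t / t > 0" and sgn: "sgn t * sgn t = 1" "1 / \<bar>t\<bar> = sgn t / t"
    using t by (auto simp: sgn_if)
  have "((\<lambda>u. sgn t * laplace r (sgn t / u)) has_field_derivative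
      sgn t * (- laplace (\<lambda>x. x * r x) (sgn t / t) * (- sgn t / t\<^sup>2))) (at t)"
    using t by (intro DERIV_cmult DERIV_chain2[where f = "laplace r" and g = "\<lambda>u. sgn t / u" and x = t, OF laplace_has_field_derivative[OF r pos]])
      (auto intro!: derivative_eq_intros simp: power2_eq_square)
  also have "sgn t * (- laplace (\<lambda>x. x * r x) (sgn t / t) * (- sgn t / t\<^sup>2)) = laplace (\<lambda>x. x * r x) (sgn t / t) * (sgn t * sgn t) / t\<^sup>2"
    by simp
  also have "\<dots> = two_sided_laplace q (pCons 0 p) t / t"
  proof -
    have "laplace (\<lambda>x. poly (pCons 0 p) (sgn t * x) * q x) (sgn t / t) = sgn t * laplace (\<lambda>x. x * r x) (sgn t / t)"
      unfolding laplace_def integral_mult_right_zero[symmetric] r_def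
      by (intro Bochner_Integration.integral_cong refl) (simp add: mult_ac)
    then show ?thesis
      unfolding two_sided_laplace_def sgn(2) by (simp add: power2_eq_square)
  qed
  finally show ?thesis
  proof (rule has_field_derivative_transform_within_open)
    show "open {u. 0 < t * u}"
      by (intro open_Collect_less continuous_intros)
    show "t \<in> {u. 0 < t * u}" using t by (auto simp: zero_less_mult_iff)
    fix u assume "u \<in> {u. 0 < t * u}"
    then have u: "u \<noteq> 0" "sgn u = sgn t" by (auto simp: sgn_if zero_less_mult_iff)
    then have "1 / \<bar>u\<bar> = sgn t / u" by (auto simp: sgn_if split: if_splits)
    then show "sgn t * laplace r (sgn t / u) = u * F u"
      using u by (simp add: F two_sided_laplace_def r_def)
  qed
qed

lemma theta_two_sided_laplace:
  assumes "laplace_transformable q" "\<And>u. u \<noteq> 0 \<Longrightarrow> F u = two_sided_laplace q p u" "t \<noteq> 0"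
  shows "theta F t = two_sided_laplace q (pCons 0 p) t"
  unfolding theta_def using DERIV_imp_deriv[OF two_sided_laplace_derivative[OF assms]] assms(3) by simp

text \<open>Divide the differentiable function u F(u) by u. This ensures that every
  \<open>deriv\<close> inside an iterate of \<open>theta\<close> is a genuine derivative away from
  0.\<close>

lemma differentiable_two_sided_laplace:
  assumes "laplace_transformable q" "\<And>u. u \<noteq> 0 \<Longrightarrow> F u = two_sided_laplace q p u" "t \<noteq> 0"
  shows "F differentiable at t"
proof -
  have "((\<lambda>u. u * F u / u) has_field_derivative
      (two_sided_laplace q (pCons 0 p) t / t * t - t * F t * 1) / (t * t)) (at t)"
    by (rule DERIV_divide[OF two_sided_laplace_derivative[OF assms] DERIV_ident assms(3)])
  then have "(F has_field_derivative
      (two_sided_laplace q (pCons 0 p) t / t * t - t * F t * 1) / (t * t)) (at t)"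
    by (rule has_field_derivative_transform_within_open[of _ _ _ "- {0}"]) (use assms(3) in auto)
  then show ?thesis
    using real_differentiable_def by blast
qed

lemma funpow_theta_two_sided_laplace:
  assumes "laplace_transformable q" "\<And>u. u \<noteq> 0 \<Longrightarrow> F u = two_sided_laplace q p u" "t \<noteq> 0"
  shows "(theta ^^ k) F t = two_sided_laplace q (monom 1 k * p) t"
  using assms(3)
proof (induction k arbitrary: t)
  case 0
  then show ?case using assms(2) by (simp flip: one_pCons)
next
  case (Suc k)
  then show ?case
    using theta_two_sided_laplace[OF assms(1) Suc.IH] by (simp add: monom_Suc)
qed

lemma poly_theta_two_sided_laplace:
  assumes q: "laplace_transformable q" and F: "\<And>u. u \<noteq> 0 \<Longrightarrow> F u = two_sided_laplace q p u" and t: "t \<noteq> 0"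
  shows "poly_theta r F t = two_sided_laplace q (r * p) t"
proof -
  define s where "s = 1 / \<bar>t\<bar>"
  have s: "s > 0" using t by (simp add: s_def)
  have int: "integrable (lebesgue_on {0..}) (\<lambda>x. exp (- (s * x)) * (poly (monom 1 k * p) (sgn t * x) * q x))" for k
    using laplace_transformable_poly_mult[OF q] s unfolding laplace_transformable_def by blast
  have "poly_theta r F t = (\<Sum>k\<le>degree r. coeff r k * (s * laplace (\<lambda>x. poly (monom 1 k * p) (sgn t * x) * q x) s))"
    by (simp add: poly_theta_def funpow_theta_two_sided_laplace[OF q F t] two_sided_laplace_def s_def)
  also have "\<dots> = s * (\<Sum>k\<le>degree r. coeff r k * laplace (\<lambda>x. poly (monom 1 k * p) (sgn t * x) * q x) s)"
    by (simp add: sum_distrib_left mult.left_commute)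
  also have "\<dots> = s * (LINT x|lebesgue_on {0..}. (\<Sum>k\<le>degree r. coeff r k * (exp (- (s * x)) * (poly (monom 1 k * p) (sgn t * x) * q x))))"
    unfolding laplace_def by (subst Bochner_Integration.integral_sum) (use int in auto)
  also have "\<dots> = two_sided_laplace q (r * p) t"
    unfolding two_sided_laplace_def laplace_def s_def[symmetric]
    by (intro arg_cong2[of _ _ _ _ "(*)"] Bochner_Integration.integral_cong refl)
      (simp add: poly_altdef[of r] poly_monom sum_distrib_left sum_distrib_right mult_ac)
  finally show ?thesis .
qed

subsection \<open>Fubini's theorem for the two-sided transform\<close>

lemma borel_measurable_poly_real [measurable]: "poly p \<in> borel_measurable borel" for p :: "real poly"
  by (intro borel_measurable_continuous_onI continuous_at_imp_continuous_on) simp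

text \<open>The indicator selects those t that have the sign of x; reflecting t reduces negative x
  to the definition of \<open>rho_kernel\<close>.\<close>

lemma has_bochner_integral_rho_kernel_abs:
  assumes x: "x \<noteq> 0"
  shows "has_bochner_integral lborel
    (\<lambda>t. indicator {0..} (x * t) * (exp (- t\<^sup>2 - \<bar>x\<bar> / \<bar>t\<bar>) / \<bar>t\<bar>)) (rho_kernel \<bar>x\<bar>)"
proof -
  let ?h = "\<lambda>t. indicator {0<..} t * (exp (- t\<^sup>2 - \<bar>x\<bar> / t) / t)"
  have h: "has_bochner_integral lborel ?h (rho_kernel \<bar>x\<bar>)"
    unfolding rho_kernel_def using x by (intro has_bochner_integral_integrable integrable_rho_kernel) simp
  show ?thesis
  proof (cases "x > 0")
    case True
    \<comment> \<open>At t = 0 both integrands are 0 because division by 0 gives 0, so closed and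
      open half-lines agree.\<close>
    then have "(\<lambda>t. indicator {0..} (x * t) * (exp (- t\<^sup>2 - \<bar>x\<bar> / \<bar>t\<bar>) / \<bar>t\<bar>)) = ?h"
      by (auto simp: fun_eq_iff indicator_def zero_le_mult_iff)
    with h show ?thesis by simp
  next
    case False
    have "has_bochner_integral lborel (\<lambda>t. ?h (0 + (- 1) * t)) (rho_kernel \<bar>x\<bar> /\<^sub>R \<bar>- 1\<bar>)"
      using h by (subst (asm) lborel_has_bochner_integral_real_affine_iff[of "- 1" _ _ 0]) auto
    moreover have "(\<lambda>t. ?h (0 + (- 1) * t)) = (\<lambda>t. indicator {0..} (x * t) * (exp (- t\<^sup>2 - \<bar>x\<bar> / \<bar>t\<bar>) / \<bar>t\<bar>))"
      using False x by (auto simp: fun_eq_iff indicator_def zero_le_mult_iff)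
    ultimately show ?thesis by simp
  qed
qed

text \<open>Evenness of \<open>q\<close> merges the transforms for \<open>t > 0\<close> and \<open>t < 0\<close> into one integral over the
  line: a given \<open>t\<close> sees only the half-line of those \<open>x\<close> that have its sign.\<close>

lemma two_sided_laplace_eq_integral:
  assumes even: "\<And>x. q (- x) = q x"
  shows "two_sided_laplace q p t * exp (- t\<^sup>2) =
    (LINT x|lebesgue. indicator {0..} (x * t) * (exp (- t\<^sup>2 - \<bar>x\<bar> / \<bar>t\<bar>) / \<bar>t\<bar>) * (poly p x * q x))"
    (is "_ = (LINT x|lebesgue. ?H x)")
proof (cases "t = 0")
  \<comment> \<open>In the remaining case t = 0 both sides vanish, again by division by 0.\<close>
  case False
  have restrict: "two_sided_laplace q p t * exp (- t\<^sup>2) =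
      (LINT x|lebesgue. indicator {0..} x * (exp (- t\<^sup>2 - x / \<bar>t\<bar>) / \<bar>t\<bar>) * (poly p (sgn t * x) * q x))"
  proof -
    have "two_sided_laplace q p t * exp (- t\<^sup>2) = (exp (- t\<^sup>2) / \<bar>t\<bar>) *
        (LINT x|lebesgue. indicator {0..} x *\<^sub>R (exp (- (1 / \<bar>t\<bar> * x)) * (poly p (sgn t * x) * q x)))"
      by (simp add: two_sided_laplace_def laplace_def integral_restrict_space)
    also have "\<dots> = (LINT x|lebesgue. (exp (- t\<^sup>2) / \<bar>t\<bar>) *
        (indicator {0..} x *\<^sub>R (exp (- (1 / \<bar>t\<bar> * x)) * (poly p (sgn t * x) * q x))))"
      by (rule integral_mult_right_zero[symmetric])
    also have "\<dots> = (LINT x|lebesgue. indicator {0..} x * (exp (- t\<^sup>2 - x / \<bar>t\<bar>) / \<bar>t\<bar>) * (poly p (sgn t * x) * q x))"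
    proof (intro Bochner_Integration.integral_cong refl)
      show "exp (- t\<^sup>2) / \<bar>t\<bar> * (indicator {0..} x *\<^sub>R (exp (- (1 / \<bar>t\<bar> * x)) * (poly p (sgn t * x) * q x))) =
        indicator {0..} x * (exp (- t\<^sup>2 - x / \<bar>t\<bar>) / \<bar>t\<bar>) * (poly p (sgn t * x) * q x)" for x
      proof -
        have "exp (- t\<^sup>2 - x / \<bar>t\<bar>) = exp (- t\<^sup>2) * exp (- (1 / \<bar>t\<bar> * x))"
          by (simp flip: exp_add)
        then show ?thesis by simp
      qed
    qed
    finally show ?thesis .
  qed
  show ?thesis
  proof (cases "t > 0")
    case True
    show ?thesis
      unfolding restrict using True
      by (intro Bochner_Integration.integral_cong refl) (auto simp: indicator_def zero_le_mult_iff)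
  next
    case neg: False
    \<comment> \<open>For t < 0 the integrand lives on x \<le> 0. Reflection moves it to x \<ge> 0,
      evenness preserves \<open>q\<close>, and the polynomial receives -x = sgn t * x.\<close>
    have "(LINT x|lebesgue. ?H x) = \<bar>- 1\<bar> *\<^sub>R (LINT x|lebesgue. ?H (0 + (- 1) * x))"
      by (rule lebesgue_integral_real_affine) simp
    also have "\<dots> = two_sided_laplace q p t * exp (- t\<^sup>2)"
      unfolding restrict using neg False even
      by (simp, intro Bochner_Integration.integral_cong refl)
        (auto simp: indicator_def mult_le_0_iff)
    finally show ?thesis ..
  qed
qed (simp add: two_sided_laplace_def)

text \<open>A single point is null. The formulas for \<open>rho\<close> and for \<open>theta\<close>
  are known only away from 0, and this carries them into integrals.\<close>

lemma has_bochner_integral_lebesgue_spike_zero: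
  fixes f g :: "real \<Rightarrow> real"
  assumes "\<And>x. x \<noteq> 0 \<Longrightarrow> f x = g x" "has_bochner_integral lebesgue g I"
  shows "has_bochner_integral lebesgue f I"
proof -
  have [measurable]: "g \<in> borel_measurable lebesgue"
    using assms(2) by (simp add: has_bochner_integral_iff borel_measurable_integrable)
  have "f = (\<lambda>x. if x \<in> {0} then f 0 else g x)"
    using assms(1) by auto
  also have "\<dots> \<in> borel_measurable lebesgue"
    by (intro measurable_If_set) auto
  finally have "f \<in> borel_measurable lebesgue" .
  moreover have "AE x in lebesgue. f x = g x"
    using AE_completion[OF AE_lborel_singleton[of "0::real"]] by eventually_elim (simp add: assms(1))
  ultimately show ?thesis
    using assms(2) by (subst has_bochner_integral_cong_AE) auto
qed

text \<open>Fubini's theorem with x in \<open>lebesgue\<close>, as \<open>q\<close> is only Lebesgue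
  measurable, and t in \<open>lborel\<close>. The kernel is nonnegative, so integrating the modulus
  over t gives the modulus of the integrand in \<open>int\<close>, which is absolute
  convergence.\<close>

lemma has_bochner_integral_two_sided_laplace:
  assumes even: "\<And>x. q (- x) = q x" and q[measurable]: "q \<in> borel_measurable lebesgue"
    and int: "integrable lebesgue (\<lambda>x. poly p x * rho_kernel \<bar>x\<bar> * q x)"
  shows "has_bochner_integral lebesgue (\<lambda>t. two_sided_laplace q p t * exp (- t\<^sup>2))
    (LINT x|lebesgue. poly p x * rho_kernel \<bar>x\<bar> * q x)"
proof -
  interpret lebesgue: sigma_finite_measure "lebesgue :: real measure"
    by (rule sigma_finite_measure_lebesgue)
  interpret pair_sigma_finite "lebesgue :: real measure" "lborel :: real measure" ..
  define H where "H = (\<lambda>x t. indicator {0..} (x * t) * (exp (- t\<^sup>2 - \<bar>x\<bar> / \<bar>t\<bar>) / \<bar>t\<bar>) * (poly p x * q x))"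
  have [measurable]: "(\<lambda>x::real. x) \<in> borel_measurable lebesgue"
    by (rule measurable_completion) simp
  have [measurable]: "(\<lambda>z. fst z :: real) \<in> borel_measurable (lebesgue \<Otimes>\<^sub>M lborel)"
    by (rule measurable_compose[OF measurable_fst]) fact
  have H_meas [measurable]: "(\<lambda>(x, t). H x t) \<in> borel_measurable (lebesgue \<Otimes>\<^sub>M lborel)"
    unfolding H_def split_beta by measurable
  have ae0: "AE x in lebesgue. x \<noteq> (0::real)"
    by (intro AE_completion AE_lborel_singleton)
  have inner: "has_bochner_integral lborel (H x) (rho_kernel \<bar>x\<bar> * (poly p x * q x))" if "x \<noteq> 0" for x
    unfolding H_def by (intro has_bochner_integral_mult_left has_bochner_integral_rho_kernel_abs that)
  have inner_abs: "(LINT t|lborel. norm (H x t)) = norm (poly p x * rho_kernel \<bar>x\<bar> * q x)" if "x \<noteq> 0" for x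
  proof -
    have "(LINT t|lborel. norm (H x t)) = (LINT t|lborel.
        indicator {0..} (x * t) * (exp (- t\<^sup>2 - \<bar>x\<bar> / \<bar>t\<bar>) / \<bar>t\<bar>) * \<bar>poly p x * q x\<bar>)"
      by (intro Bochner_Integration.integral_cong refl) (simp add: H_def abs_mult)
    also have "\<dots> = rho_kernel \<bar>x\<bar> * \<bar>poly p x * q x\<bar>"
      by (intro has_bochner_integral_integral_eq has_bochner_integral_mult_left has_bochner_integral_rho_kernel_abs that)
    finally show ?thesis
      using rho_kernel_pos[of "\<bar>x\<bar>"] that by (simp add: abs_mult)
  qed
  have H_int: "integrable (lebesgue \<Otimes>\<^sub>M lborel) (\<lambda>(x, t). H x t)"
  proof (rule Fubini_integrable)
    have "has_bochner_integral lebesgue (\<lambda>x. LINT t|lborel. norm (H x t))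
        (LINT x|lebesgue. norm (poly p x * rho_kernel \<bar>x\<bar> * q x))"
      by (rule has_bochner_integral_lebesgue_spike_zero[OF inner_abs has_bochner_integral_integrable[OF integrable_norm[OF int]]])
    then show "integrable lebesgue (\<lambda>x. LINT t|lborel. norm (case (x, t) of (x, t) \<Rightarrow> H x t))"
      by (simp add: has_bochner_integral_iff)
    show "AE x in lebesgue. integrable lborel (\<lambda>t. case (x, t) of (x, t) \<Rightarrow> H x t)"
      using ae0 by eventually_elim (use inner in \<open>simp add: has_bochner_integral_iff\<close>)
  qed measurable
  have outer: "(LINT x|lebesgue. H x t) = two_sided_laplace q p t * exp (- t\<^sup>2)" for t
    unfolding H_def by (rule two_sided_laplace_eq_integral[symmetric]) (rule even)
  have L: "integrable lborel (\<lambda>t. two_sided_laplace q p t * exp (- t\<^sup>2))"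
    using integrable_snd[OF H_int] unfolding outer .
  have "(LINT t|lborel. two_sided_laplace q p t * exp (- t\<^sup>2)) = (LINT x|lebesgue. LINT t|lborel. H x t)"
    using Fubini_integral[OF H_int] unfolding outer .
  also have "(LINT x|lebesgue. LINT t|lborel. H x t) = (LINT x|lebesgue. poly p x * rho_kernel \<bar>x\<bar> * q x)"
    by (rule has_bochner_integral_integral_eq, rule has_bochner_integral_lebesgue_spike_zero[OF _ has_bochner_integral_integrable[OF int]])
      (simp add: has_bochner_integral_integral_eq[OF inner] mult_ac)
  finally show ?thesis
    using L borel_measurable_integrable[OF L]
    by (simp add: has_bochner_integral_iff integrable_completion integral_completion)
qed

section \<open>The compositional orthogonality relation\<close>

theorem proposition2:
  fixes \<phi> \<psi> :: "real \<Rightarrow> real" and P :: "nat \<Rightarrow> real poly" and \<gamma> :: real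
  assumes "\<gamma> > 0"
    and "\<And>t. t > 0 \<Longrightarrow> \<phi> t \<ge> 0"
    and "\<And>x. \<psi> x \<ge> 0"
    and "\<And>t. t \<noteq> 0 \<Longrightarrow>
           \<phi> \<bar>t\<bar> = 1 / \<bar>t\<bar> * (LINT x:{0..}|lebesgue. exp (- x / \<bar>t\<bar>) * \<psi> x)"
    and "\<And>x. \<psi> (- x) = \<psi> x"
    and "\<exists>M>0. \<forall>k::nat. set_integrable lebesgue {0..} (\<lambda>x. x ^ k * exp (- x / M) * \<psi> x)"
    and "\<forall>k::nat. integrable lebesgue (\<lambda>x. \<bar>x\<bar> ^ k * rho \<gamma> (1/2) 2 (x\<^sup>2 / 4) * \<psi> x)"
    and "orthonormal_polys
           (density lebesgue (\<lambda>x. ennreal (1 / (2 * sqrt pi) * rho \<gamma> (1/2) 2 (x\<^sup>2 / 4) * \<psi> x))) P"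
  shows "(\<forall>k t. t \<noteq> 0 \<longrightarrow> (theta ^^ k) (\<lambda>t. \<phi> \<bar>t\<bar>) differentiable at t) \<and>
    (\<forall>n m.
      integrable lebesgue
        (\<lambda>t. poly_theta (P n) (poly_theta (P m) (\<lambda>t. \<phi> \<bar>t\<bar>)) t * exp (- t\<^sup>2)) \<and>
      integrable lebesgue
        (\<lambda>x. poly (P n) x * poly (P m) x * rho \<gamma> (1/2) 2 (x\<^sup>2 / 4) * \<psi> x / (2 * sqrt pi)) \<and>
      (LINT t|lebesgue. poly_theta (P n) (poly_theta (P m) (\<lambda>t. \<phi> \<bar>t\<bar>)) t * exp (- t\<^sup>2))
        = (LINT x|lebesgue.
             poly (P n) x * poly (P m) x * rho \<gamma> (1/2) 2 (x\<^sup>2 / 4) * \<psi> x / (2 * sqrt pi)) \<and>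
      (LINT x|lebesgue.
             poly (P n) x * poly (P m) x * rho \<gamma> (1/2) 2 (x\<^sup>2 / 4) * \<psi> x / (2 * sqrt pi))
        = of_bool (n = m))"
proof -
  define w where "w = (\<lambda>x. 1 / (2 * sqrt pi) * rho \<gamma> (1/2) 2 (x\<^sup>2 / 4) * \<psi> x)"
  have w: "w x = rho_kernel \<bar>x\<bar> * \<psi> x" if "x \<noteq> 0" for x
    unfolding w_def rho_half_two[OF assms(1) that] by simp
  have w_nonneg: "w x \<ge> 0" for x
  proof (cases "x = 0")
    \<comment> \<open>A power of 0 is 0 by convention, so \<open>rho\<close> vanishes at 0.\<close>
    case True
    then show ?thesis by (simp add: w_def rho_def vertical_integral_def)
  next
    case False
    then show ?thesis using rho_kernel_pos[of "\<bar>x\<bar>"] assms(3)[of x] by (simp add: w)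
  qed
  have w_moments: "integrable lebesgue (\<lambda>x. \<bar>x\<bar> ^ k * w x)" for k
    using integrable_mult_right[OF assms(7)[rule_format, of k], of "1 / (2 * sqrt pi)"]
    by (simp add: w_def mult_ac)
  have [measurable]: "(\<lambda>x::real. x) \<in> borel_measurable lebesgue"
    by (rule measurable_completion) simp
  have w_meas [measurable]: "w \<in> borel_measurable lebesgue"
    using borel_measurable_integrable[OF w_moments[of 0]] by simp
  have w_poly: "integrable lebesgue (\<lambda>x. poly p x * w x)" for p
  proof -
    have "integrable lebesgue (\<lambda>x. x ^ k * w x)" for k
      by (rule Bochner_Integration.integrable_bound[OF w_moments[of k]]) (auto simp: abs_mult power_abs)
    then have "integrable lebesgue (\<lambda>x. \<Sum>k\<le>degree p. coeff p k * (x ^ k * w x))"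
      by (intro Bochner_Integration.integrable_sum integrable_mult_right)
    then show ?thesis
      by (simp add: poly_altdef sum_distrib_right mult.assoc)
  qed
  \<comment> \<open>Measurability of \<psi> on the whole line is recovered from that of the weighted
    density by dividing by the positive kernel; the value at 0 is inserted by hand.\<close>
  have \<psi>_meas [measurable]: "\<psi> \<in> borel_measurable lebesgue"
  proof -
    have "\<psi> = (\<lambda>x. if x \<in> {0} then \<psi> 0 else w x / rho_kernel \<bar>x\<bar>)"
      using rho_kernel_pos[of "\<bar>x\<bar>" for x] by (auto simp: fun_eq_iff w order.strict_iff_order)
    also have "\<dots> \<in> borel_measurable lebesgue"
      by (intro measurable_If_set) auto
    finally show ?thesis .
  qed
  \<comment> \<open>Since e^(-\<epsilon> x) is at most a multiple of \<open>rho_kernel x\<close>,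
    the zeroth moment of \<open>w\<close> dominates the Laplace integrand for every
    \<epsilon>.\<close>
  have \<psi>: "laplace_transformable \<psi>"
    unfolding laplace_transformable_def
  proof (intro allI impI)
    fix \<epsilon> :: real assume "\<epsilon> > 0"
    then obtain C where C: "C > 0" "\<And>x. x > 0 \<Longrightarrow> exp (- x / (1 / \<epsilon>)) \<le> C * rho_kernel x"
      using exp_le_rho_kernel[of "1 / \<epsilon>"] by auto
    have "integrable lebesgue (\<lambda>x. C * (\<bar>x\<bar> ^ 0 * w x))"
      by (intro integrable_mult_right w_moments)
    then have "integrable lebesgue (\<lambda>x. indicator {0..} x *\<^sub>R (exp (- (\<epsilon> * x)) * \<psi> x))"
    proof (rule Bochner_Integration.integrable_bound)
      have *: "norm (indicator {0..} x *\<^sub>R (exp (- (\<epsilon> * x)) * \<psi> x)) \<le> norm (C * (\<bar>x\<bar> ^ 0 * w x))" if "x \<noteq> 0" for x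
      proof (cases "x > 0")
        case True
        then have "exp (- (\<epsilon> * x)) * \<psi> x \<le> C * rho_kernel x * \<psi> x"
          using C(2)[of x] assms(3)[of x] by (intro mult_right_mono) (simp_all add: mult.commute)
        then show ?thesis
          using True rho_kernel_pos[OF True] C(1) assms(3)[of x] by (simp add: w abs_mult mult.assoc)
      qed (use that in simp)
      show "AE x in lebesgue. norm (indicator {0..} x *\<^sub>R (exp (- (\<epsilon> * x)) * \<psi> x)) \<le> norm (C * (\<bar>x\<bar> ^ 0 * w x))"
        using AE_completion[OF AE_lborel_singleton[of "0::real"]] by eventually_elim (rule *)
    qed measurable
    then show "integrable (lebesgue_on {0..}) (\<lambda>x. exp (- (\<epsilon> * x)) * \<psi> x)"
      by (subst integrable_restrict_space) auto
  qed
  have \<phi>: "\<phi> \<bar>t\<bar> = two_sided_laplace \<psi> 1 t" if "t \<noteq> 0" for t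
    using assms(4)[OF that]
    by (simp add: two_sided_laplace_def laplace_def integral_restrict_space set_lebesgue_integral_def)
  have diff: "(theta ^^ k) (\<lambda>t. \<phi> \<bar>t\<bar>) differentiable at t" if "t \<noteq> 0" for k t
    by (rule differentiable_two_sided_laplace[OF \<psi> funpow_theta_two_sided_laplace[OF \<psi> \<phi>] that])
  \<comment> \<open>The transform formula is used twice. The inner application describes its
    function only away from 0, which is all that the outer one asks for, and the polynomials
    multiply.\<close>
  have poly_theta: "poly_theta (P n) (poly_theta (P m) (\<lambda>t. \<phi> \<bar>t\<bar>)) t = two_sided_laplace \<psi> (P n * P m) t"
    if "t \<noteq> 0" for n m t
    using poly_theta_two_sided_laplace[OF \<psi> poly_theta_two_sided_laplace[OF \<psi> \<phi>] that] by simp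
  have kernel: "has_bochner_integral lebesgue (\<lambda>x. poly p x * rho_kernel \<bar>x\<bar> * \<psi> x) (LINT x|lebesgue. poly p x * w x)" for p
    by (rule has_bochner_integral_lebesgue_spike_zero[OF _ has_bochner_integral_integrable[OF w_poly]]) (simp add: w)
  have "has_bochner_integral lebesgue (\<lambda>t. poly_theta (P n) (poly_theta (P m) (\<lambda>t. \<phi> \<bar>t\<bar>)) t * exp (- t\<^sup>2))
      (LINT x|lebesgue. poly (P n * P m) x * w x)" for n m
  proof (rule has_bochner_integral_lebesgue_spike_zero)
    show "has_bochner_integral lebesgue (\<lambda>t. two_sided_laplace \<psi> (P n * P m) t * exp (- t\<^sup>2))
        (LINT x|lebesgue. poly (P n * P m) x * w x)"
      using has_bochner_integral_two_sided_laplace[OF assms(5) \<psi>_meas, of "P n * P m"] kernel[of "P n * P m"]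
      by (simp add: has_bochner_integral_iff)
  qed (simp add: poly_theta)
  moreover have "poly (P n) x * poly (P m) x * rho \<gamma> (1/2) 2 (x\<^sup>2 / 4) * \<psi> x / (2 * sqrt pi) = poly (P n * P m) x * w x" for n m x
    by (simp add: w_def)
  moreover have "(LINT x|lebesgue. poly (P n * P m) x * w x) = of_bool (n = m)" for n m
  proof -
    have "(LINT x|density lebesgue (\<lambda>x. ennreal (w x)). poly (P n) x * poly (P m) x) = of_bool (n = m)"
      using assms(8) unfolding orthonormal_polys_def w_def by blast
    then show ?thesis
      by (subst (asm) integral_density) (use w_nonneg in \<open>auto simp: mult_ac\<close>)
  qed
  ultimately show ?thesis
    using diff w_poly[of "P n * P m" for n m] by (simp add: has_bochner_integral_iff)
qed

end
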